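(* (Slice and Push Inequality.) Let $\lambda$ be a partition and let $(D;F)$ be a circle-square diagram of $\mathbb{D}(\lambda)$ such that $D^{\circ}=\mathbb{D}(\mu)$ for some nonempty partition $\mu\subseteq\lambda$. Then for any integer $k\ge 0$, \[ \mathrm{wt}(D;F)\ \geq\ \mathrm{wt}\bigl(D|_{k};\ F\sqcup(|_{k}D)^{\rightarrow}\bigr). \]
   Context: A partition $\lambda=(\lambda_1\ge\lambda_2\ge\cdots)$ is a weakly decreasing sequence of nonnegative integers that is eventually $0$. Its Young diagram $\mathbb{D}(\lambda)$ is the left-justified array of cells $c_{i,j}$ ($i$-th row from the top, $j$-th column), $1\le j\le\lambda_i$. The hook length $h(c)$ of $c\in\mathbb{D}(\lambda)$ is the number of cells of $\mathbb{D}(\lambda)$ lying in the same row weakly to the right of $c$ or in the same column strictly below $c$. For $k\in\mathbb{Z}$, $X_k=\{c_{i,j}\in\mathbb{D}(\lambda): j-i=k\}$. Cells are partially ordered by $c_{i,j}\le c_{i',j'}$ iff $i\le i'$ and $j\le j'$. A subdiagram of $\mathbb{D}(\lambda)$ is a finite subset of its cells; a multi-subdiagram is a finite multiset of cells of $\mathbb{D}(\lambda)$. $\sqcup$ denotes multiset union (multiplicities add). The weight $\mathrm{wt}(G)$ of a multi-subdiagram $G$ is the product of the hook lengths (in $\mathbb{D}(\lambda)$) of its cells, taken with multiplicity. A circle-square diagram of $\mathbb{D}(\lambda)$ is a pair $(D;F)$ where $D$ is a subdiagram and $F$ is a multi-subdiagram of $\mathbb{D}(\lambda)$ such that for every $c_{i,j}\in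 D$ the cell $c_{i+1,j+1}$ is in $\mathbb{D}(\lambda)$. Its weight $\mathrm{wt}(D;F)$ is the sum of $\mathrm{wt}(D'\sqcup F)$ over all subdiagrams $D'$ such that there exists a bijection $\eta:D\to D'$ with $\eta(c_{i,j})\in\{c_{i,j},c_{i+1,j+1}\}$ for all $c_{i,j}\in D$, and such that for each $k\in\mathbb{Z}$ the restriction of $\eta$ to $D\cap(X_k\cup X_{k+1})$ is order-preserving. For a subdiagram $D$: $D|_k$ is the set of cells of $D$ in the first $k$ columns of $\mathbb{D}(\lambda)$; $|_kD$ is the set of cells of $D$ not in the first $k$ columns; $D^{\rightarrow}=\{c_{i,j+1}: c_{i,j}\in D\}$. If $i_0$ (resp. $j_0$) is the first row (resp. column) containing a cell of $D$, then $D^{\circ}=\{c_{i-i_0+1,\,j-j_0+1}: c_{i,j}\in D\}$. *)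

theory Defs
  imports "HOL-Library.Multiset" "HOL-Library.Product_Order"
begin

text \<open>
  A partition is a function on row indices starting at 1; its value at 0 is irrelevant.
  A cell is a pair (row, column), both starting at 1. The componentwise order of
  \<^theory>\<open>HOL-Library.Product_Order\<close> is the partial order on cells.
\<close>

type_synonym cell = "nat \<times> nat"

definition is_partition :: "(nat \<Rightarrow> nat) \<Rightarrow> bool" where
  "is_partition lam \<longleftrightarrow>
     (\<forall>i\<ge>1. lam (i + 1) \<le> lam i) \<and> (\<exists>N. \<forall>i\<ge>N. lam i = 0)"

definition young_diagram :: "(nat \<Rightarrow> nat) \<Rightarrow> cell set" where
  "young_diagram lam = {(i, j). 1 \<le> i \<and> 1 \<le> j \<and> j \<le> lam i}"

definition hook_length :: "(nat \<Rightarrow> nat) \<Rightarrow> cell \<Rightarrow> nat" where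
  "hook_length lam c =
     card {d \<in> young_diagram lam.
             (fst d = fst c \<and> snd c \<le> snd d) \<or> (snd d = snd c \<and> fst c < fst d)}"

definition diagonal :: "(nat \<Rightarrow> nat) \<Rightarrow> int \<Rightarrow> cell set" where
  "diagonal lam k = {(i, j) \<in> young_diagram lam. int j - int i = k}"

definition subdiagram :: "(nat \<Rightarrow> nat) \<Rightarrow> cell set \<Rightarrow> bool" where
  "subdiagram lam D \<longleftrightarrow> finite D \<and> D \<subseteq> young_diagram lam"

definition multi_subdiagram :: "(nat \<Rightarrow> nat) \<Rightarrow> cell multiset \<Rightarrow> bool" where
  "multi_subdiagram lam G \<longleftrightarrow> set_mset G \<subseteq> young_diagram lam"

definition wt :: "(nat \<Rightarrow> nat) \<Rightarrow> cell multiset \<Rightarrow> nat" where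
  "wt lam G = (\<Prod>c\<in>#G. hook_length lam c)"

definition circle_square :: "(nat \<Rightarrow> nat) \<Rightarrow> cell set \<Rightarrow> cell multiset \<Rightarrow> bool" where
  "circle_square lam D F \<longleftrightarrow>
     subdiagram lam D \<and> multi_subdiagram lam F \<and>
     (\<forall>(i, j)\<in>D. (i + 1, j + 1) \<in> young_diagram lam)"

definition admissible_move ::
    "(nat \<Rightarrow> nat) \<Rightarrow> cell set \<Rightarrow> cell set \<Rightarrow> (cell \<Rightarrow> cell) \<Rightarrow> bool" where
  "admissible_move lam D D' \<eta> \<longleftrightarrow>
     bij_betw \<eta> D D' \<and>
     (\<forall>(i, j)\<in>D. \<eta> (i, j) \<in> {(i, j), (i + 1, j + 1)}) \<and>
     (\<forall>k::int. mono_on (D \<inter> (diagonal lam k \<union> diagonal lam (k + 1))) \<eta>)"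

definition wt_cs :: "(nat \<Rightarrow> nat) \<Rightarrow> cell set \<Rightarrow> cell multiset \<Rightarrow> nat" where
  "wt_cs lam D F =
     (\<Sum>D' \<in> {D'. subdiagram lam D' \<and> (\<exists>\<eta>. admissible_move lam D D' \<eta>)}.
        wt lam (mset_set D' + F))"

definition first_columns :: "nat \<Rightarrow> cell set \<Rightarrow> cell set" where
  "first_columns k D = {(i, j) \<in> D. j \<le> k}"

definition later_columns :: "nat \<Rightarrow> cell set \<Rightarrow> cell set" where
  "later_columns k D = {(i, j) \<in> D. k < j}"

definition push_right :: "cell set \<Rightarrow> cell set" where
  "push_right D = (\<lambda>(i, j). (i, j + 1)) ` D"

text \<open>
  The translate of \<open>D\<close> whose first row and first column are 1. The truncated
  subtractions are exact, and the minima are only relevant for nonempty \<open>D\<close>.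
\<close>

definition normalized :: "cell set \<Rightarrow> cell set" where
  "normalized D =
     (let i0 = Min (fst ` D); j0 = Min (snd ` D)
      in (\<lambda>(i, j). (i - i0 + 1, j - j0 + 1)) ` D)"

text \<open>
  Finiteness of the diagram guarantees that the cardinality in \<^const>\<open>hook_length\<close>
  and the sum in \<^const>\<open>wt_cs\<close> are over finite sets.
\<close>

lemma finite_young_diagram:
  assumes "is_partition lam"
  shows "finite (young_diagram lam)"
proof -
  obtain N where N: "\<And>i. i \<ge> N \<Longrightarrow> lam i = 0"
    using assms unfolding is_partition_def by blast
  have "young_diagram lam \<subseteq> (SIGMA i:{..<N}. {..lam i})"
  proof
    fix c assume "c \<in> young_diagram lam"
    then obtain i j where c: "c = (i, j)" "1 \<le> j" "j \<le> lam i"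
      by (auto simp: young_diagram_def)
    have "i < N"
      using N[of i] c(2,3) by (cases "i < N") auto
    then show "c \<in> (SIGMA i:{..<N}. {..lam i})"
      using c by simp
  qed
  then show ?thesis
    by (rule finite_subset) simp
qed

end

theory Submission imports Defs begin

text \<open>
  If \<open>D\<close> is a translate of a straight shape, the cells that an admissible move leaves in
  place form a lower set \<open>V\<close> of \<open>D\<close>, every lower set arises, and \<open>V\<close> can be recovered from
  the outcome. Writing \<open>h\<close> for the hook length, \<open>wt (D; F)\<close> is therefore \<open>wt F\<close> times
  \<open>W(D) = (\<Sum>V. (\<Prod>c\<in>V. h c) * (\<Prod>c\<in>D - V. h (c + (1, 1))))\<close>, summed over the lower sets of
  \<open>D\<close>. This is \<open>wt_cs_eq_lower_sum\<close>.

  Slicing can be done one column at a time, so it suffices to cut off the last nonempty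
  column \<open>m\<close> of \<open>D\<close>. Let \<open>Q\<close> be the product of the hook lengths of its cells after they have
  been pushed to column \<open>m + 1\<close>. The claim becomes \<open>Q * W(D without column m) \<le> W(D)\<close>.

  Choosing a cell \<open>c\<close> and asking whether \<open>c \<in> V\<close> gives
  \<open>W(D) = p * W(D - {d. d \<le> c}) + q * W(D - {d. c \<le> d})\<close> with nonnegative \<open>p\<close> and \<open>q\<close>
  (\<open>lower_sum_split\<close>). If \<open>c\<close> lies below the lowest cell of column \<open>m\<close>, neither \<open>p\<close> nor \<open>q\<close>
  involves that column, so the claim for \<open>D\<close> follows from the claim for the two smaller
  sets. Each of them is again a rectangle ending in column \<open>m\<close> together with some cells
  below it and to the left of column \<open>m\<close>. Repeating this removes all the cells below the
  rectangle (\<open>lower_sum_slice\<close>).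

  On a rectangle the hook length splits as \<open>h (i, j) = x i + y j\<close>, and \<open>W\<close> is a factorial
  Schur function of a rectangular shape, symmetric in the variables \<open>x\<close> of the rows that it
  involves. The split at the top right cell produces the term
  \<open>(\<Prod>i. x (i + 1) + y (m + 1)) * W(rectangle without column m)\<close>. By symmetry \<open>x (i + 1)\<close> may
  be replaced by \<open>x i\<close> here, which turns the product into \<open>Q\<close>; the other term stays a product
  of nonnegative quantities (\<open>box_sum_split_reflected\<close>). So the inequality is an identity with
  an explicit nonnegative remainder.
\<close>

section \<open>Weighted sums over lower sets\<close>

definition lower_sets :: "'a::order set \<Rightarrow> 'a set set" where
  "lower_sets D = {V. V \<subseteq> D \<and> (\<forall>c\<in>V. \<forall>d\<in>D. d \<le> c \<longrightarrow> d \<in> V)}"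

definition lower_sum ::
    "('a::order \<Rightarrow> 'b::comm_semiring_1) \<Rightarrow> ('a \<Rightarrow> 'b) \<Rightarrow> 'a set \<Rightarrow> 'b" where
  "lower_sum f g D = (\<Sum>V\<in>lower_sets D. prod f V * prod g (D - V))"

lemma finite_lower_sets: "finite D \<Longrightarrow> finite (lower_sets D)"
  by (rule finite_subset[of _ "Pow D"]) (auto simp: lower_sets_def)

lemma lower_sum_empty [simp]: "lower_sum f g ({} :: 'c::order set) = 1"
proof -
  have "lower_sets ({} :: 'c::order set) = {{}}" by (auto simp: lower_sets_def)
  then show ?thesis by (simp add: lower_sum_def)
qed

lemma lower_sum_cong:
  assumes "\<And>c. c \<in> D \<Longrightarrow> f c = f' c" "\<And>c. c \<in> D \<Longrightarrow> g c = g' c"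
  shows "lower_sum f g D = lower_sum f' g' D"
  unfolding lower_sum_def
proof (rule sum.cong[OF refl])
  fix V assume "V \<in> lower_sets D"
  then have "V \<subseteq> D" by (simp add: lower_sets_def)
  then have "prod f V = prod f' V" "prod g (D - V) = prod g' (D - V)"
    using assms by (auto intro!: prod.cong)
  then show "prod f V * prod g (D - V) = prod f' V * prod g' (D - V)" by simp
qed

lemma of_nat_lower_sum:
  "of_nat (lower_sum f g D) = lower_sum (\<lambda>c. of_nat (f c)) (\<lambda>c. of_nat (g c)) D"
  by (simp add: lower_sum_def)

lemma lower_sum_nonneg:
  fixes f g :: "'a::order \<Rightarrow> 'b::linordered_semidom"
  assumes "\<And>c. c \<in> D \<Longrightarrow> 0 \<le> f c" "\<And>c. c \<in> D \<Longrightarrow> 0 \<le> g c"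
  shows "0 \<le> lower_sum f g D"
  unfolding lower_sum_def
  by (intro sum_nonneg mult_nonneg_nonneg prod_nonneg) (use assms in \<open>auto simp: lower_sets_def\<close>)

text \<open>
  A lower set either contains \<open>c\<close>, and then everything below \<open>c\<close>, or it avoids \<open>c\<close>, and
  then everything above \<open>c\<close>. Either way, what remains to be chosen is an arbitrary lower
  set of the remaining cells.
\<close>

lemma lower_sum_split:
  assumes fin: "finite D" and c: "c \<in> D"
  shows "lower_sum f g D =
           prod f {d\<in>D. d \<le> c} * lower_sum f g (D - {d\<in>D. d \<le> c})
         + prod g {d\<in>D. c \<le> d} * lower_sum f g (D - {d\<in>D. c \<le> d})"
proof -
  define L where "L = {d\<in>D. d \<le> c}"
  define U where "U = {d\<in>D. c \<le> d}"
  have finLU: "finite L" "finite U" using fin by (auto simp: L_def U_def)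
  have LU: "L \<subseteq> D" "U \<subseteq> D" by (auto simp: L_def U_def)
  let ?w = "\<lambda>V. prod f V * prod g (D - V)"
  have "lower_sum f g D = sum ?w ({V\<in>lower_sets D. c \<in> V} \<union> {V\<in>lower_sets D. c \<notin> V})"
    unfolding lower_sum_def by (rule sum.cong) auto
  also have "\<dots> = sum ?w {V\<in>lower_sets D. c \<in> V} + sum ?w {V\<in>lower_sets D. c \<notin> V}"
    by (rule sum.union_disjoint) (use finite_lower_sets[OF fin] in auto)
  also have "sum ?w {V\<in>lower_sets D. c \<in> V} = prod f L * lower_sum f g (D - L)"
  proof -
    have im: "{V\<in>lower_sets D. c \<in> V} = (\<lambda>V. L \<union> V) ` lower_sets (D - L)"
    proof (intro equalityI subsetI)
      fix V assume V: "V \<in> {V\<in>lower_sets D. c \<in> V}"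
      then have "V = L \<union> (V - L)" by (auto simp: lower_sets_def L_def)
      moreover have "V - L \<in> lower_sets (D - L)" using V by (auto simp: lower_sets_def)
      ultimately show "V \<in> (\<lambda>V. L \<union> V) ` lower_sets (D - L)" by blast
    next
      fix V assume "V \<in> (\<lambda>V. L \<union> V) ` lower_sets (D - L)"
      then obtain V' where V': "V = L \<union> V'" "V' \<in> lower_sets (D - L)" by auto
      show "V \<in> {V\<in>lower_sets D. c \<in> V}"
        using V' c unfolding lower_sets_def L_def by (auto intro: order_trans)
    qed
    have inj: "inj_on (\<lambda>V. L \<union> V) (lower_sets (D - L))"
      by (rule inj_on_inverseI[where g = "\<lambda>W. W - L"]) (auto simp: lower_sets_def)
    have "sum ?w {V\<in>lower_sets D. c \<in> V} = (\<Sum>V\<in>lower_sets (D - L). ?w (L \<union> V))"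
      unfolding im by (subst sum.reindex[OF inj]) simp
    also have "\<dots> = (\<Sum>V\<in>lower_sets (D - L). prod f L * (prod f V * prod g (D - L - V)))"
    proof (rule sum.cong[OF refl])
      fix V assume "V \<in> lower_sets (D - L)"
      then have V: "V \<subseteq> D - L" by (simp add: lower_sets_def)
      then have "prod f (L \<union> V) = prod f L * prod f V"
        using fin finLU by (intro prod.union_disjoint) (auto intro: finite_subset)
      moreover have "D - (L \<union> V) = D - L - V" by auto
      ultimately show "?w (L \<union> V) = prod f L * (prod f V * prod g (D - L - V))"
        by (simp add: mult.assoc)
    qed
    finally show ?thesis by (simp add: lower_sum_def sum_distrib_left)
  qed
  also have "sum ?w {V\<in>lower_sets D. c \<notin> V} = prod g U * lower_sum f g (D - U)"
  proof -
    have eq: "{V\<in>lower_sets D. c \<notin> V} = lower_sets (D - U)"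
    proof (intro equalityI subsetI)
      fix V assume "V \<in> {V\<in>lower_sets D. c \<notin> V}"
      then show "V \<in> lower_sets (D - U)" using c by (auto simp: lower_sets_def U_def)
    next
      fix V assume "V \<in> lower_sets (D - U)"
      then show "V \<in> {V\<in>lower_sets D. c \<notin> V}"
        using c unfolding lower_sets_def U_def by (auto dest: order_trans)
    qed
    have "sum ?w {V\<in>lower_sets D. c \<notin> V}
        = (\<Sum>V\<in>lower_sets (D - U). prod g U * (prod f V * prod g (D - U - V)))"
      unfolding eq
    proof (rule sum.cong[OF refl])
      fix V assume "V \<in> lower_sets (D - U)"
      then have "D - V = U \<union> (D - U - V)" using LU by (auto simp: lower_sets_def)
      moreover have "prod g (U \<union> (D - U - V)) = prod g U * prod g (D - U - V)"
        by (rule prod.union_disjoint) (use fin finLU in auto)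
      ultimately have "prod g (D - V) = prod g U * prod g (D - U - V)" by simp
      then show "?w V = prod g U * (prod f V * prod g (D - U - V))" by (simp add: ac_simps)
    qed
    then show ?thesis by (simp add: lower_sum_def sum_distrib_left)
  qed
  finally show ?thesis unfolding L_def U_def .
qed

section \<open>Rectangles with additive weights\<close>

text \<open>
  The rows are \<open>a..<a'\<close> and the columns \<open>b..<b'\<close>. Half-open bounds make empty rectangles
  available as the start of the recursions, while the variables involved are
  \<open>x a, \<dots>, x a'\<close> and \<open>y b, \<dots>, y b'\<close>, because cells may slide out of the rectangle by one.
\<close>

definition box_sum ::
    "(nat \<Rightarrow> int) \<Rightarrow> (nat \<Rightarrow> int) \<Rightarrow> nat \<Rightarrow> nat \<Rightarrow> nat \<Rightarrow> nat \<Rightarrow> int" where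
  "box_sum x y a a' b b' =
     lower_sum (\<lambda>(i, j). x i + y j) (\<lambda>(i, j). x (Suc i) + y (Suc j)) ({a..<a'} \<times> {b..<b'})"

lemma box_sum_empty [simp]:
  "box_sum x y a a b b' = 1" "box_sum x y a a' b b = 1"
  by (simp_all add: box_sum_def)

text \<open>
  The split at the top right cell: either the whole first row stays, or the whole last
  column moves.
\<close>

lemma box_sum_split:
  assumes "a < a'" "b \<le> m"
  shows "box_sum x y a a' b (Suc m) =
           (\<Prod>i\<in>{a..<a'}. x (Suc i) + y (Suc m)) * box_sum x y a a' b m
         + (\<Prod>j\<in>{b..<Suc m}. x a + y j) * box_sum x y (Suc a) a' b (Suc m)"
proof -
  let ?D = "{a..<a'} \<times> {b..<Suc m}"
  let ?f = "\<lambda>(i, j). x i + y j" and ?g = "\<lambda>(i, j). x (Suc i) + y (Suc j)"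
  have L: "{d\<in>?D. d \<le> (a, m)} = Pair a ` {b..<Suc m}"
    and U: "{d\<in>?D. (a, m) \<le> d} = (\<lambda>i. (i, m)) ` {a..<a'}"
    using assms by auto
  have DL: "?D - Pair a ` {b..<Suc m} = {Suc a..<a'} \<times> {b..<Suc m}"
    and DU: "?D - (\<lambda>i. (i, m)) ` {a..<a'} = {a..<a'} \<times> {b..<m}"
    using assms by (auto simp: image_iff)
  have PL: "prod ?f (Pair a ` {b..<Suc m}) = (\<Prod>j\<in>{b..<Suc m}. x a + y j)"
    by (subst prod.reindex) (auto simp: inj_on_def)
  have PU: "prod ?g ((\<lambda>i. (i, m)) ` {a..<a'}) = (\<Prod>i\<in>{a..<a'}. x (Suc i) + y (Suc m))"
    by (subst prod.reindex) (auto simp: inj_on_def)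
  have "(a, m) \<in> ?D" using assms by auto
  from lower_sum_split[OF _ this, of ?f ?g] show ?thesis
    unfolding L U DL DU PL PU box_sum_def by simp
qed

text \<open>
  Exchanging the roles of \<open>x a\<close> and \<open>x (Suc e)\<close>, the first and the last row variable, in the
  recursion \<open>box_sum_split\<close>. By induction on the number of rows, the two recursions have the
  same value as soon as rectangles with one column less satisfy a divided difference formula.
\<close>

lemma box_sum_split_reflected_if:
  assumes dd: "\<And>a e. a \<le> e \<Longrightarrow> (x a - x (Suc e)) * box_sum x y a (Suc e) b m =
           (\<Prod>j\<in>{b..<Suc m}. x a + y j) * box_sum x y (Suc a) (Suc e) b m
         - (\<Prod>j\<in>{b..<Suc m}. x (Suc e) + y j) * box_sum x y a e b m"
    and bm: "b \<le> m" and "a \<le> e"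
  shows "box_sum x y a (Suc e) b (Suc m) =
           (\<Prod>i\<in>{a..<Suc e}. x i + y (Suc m)) * box_sum x y a (Suc e) b m
         + (\<Prod>j\<in>{b..<Suc m}. x (Suc e) + y j) * box_sum x y a e b (Suc m)"
  using \<open>a \<le> e\<close>
proof (induction a rule: inc_induct)
  case base
  let ?P = "\<lambda>i. \<Prod>j\<in>{b..<Suc m}. x i + y j"
  have "box_sum x y e (Suc e) b (Suc m)
      = (x (Suc e) + y (Suc m)) * box_sum x y e (Suc e) b m + ?P e"
    using box_sum_split[of e "Suc e" b m x y] bm by simp
  moreover have "(x e - x (Suc e)) * box_sum x y e (Suc e) b m = ?P e - ?P (Suc e)"
    using dd[of e e] by simp
  moreover have "(\<Prod>i\<in>{e..<Suc e}. x i + y (Suc m)) = x e + y (Suc m)" by simp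
  ultimately show ?case unfolding box_sum_empty by (simp only:) algebra
next
  case (step a)
  then have ae: "a < e" by simp
  let ?P = "\<lambda>i. \<Prod>j\<in>{b..<Suc m}. x i + y j"
  \<comment> \<open>The common factor of the three last-column products.\<close>
  define Q where "Q = (\<Prod>i\<in>{Suc a..<Suc e}. x i + y (Suc m))"
  have Q1: "(\<Prod>i\<in>{a..<Suc e}. x (Suc i) + y (Suc m)) = Q * (x (Suc e) + y (Suc m))"
  proof -
    have "(\<Prod>i\<in>{a..<Suc e}. x (Suc i) + y (Suc m)) = (\<Prod>i\<in>{Suc a..<Suc (Suc e)}. x i + y (Suc m))"
      by (rule prod.shift_bounds_Suc_ivl[symmetric])
    also have "\<dots> = Q * (x (Suc e) + y (Suc m))"
      unfolding Q_def using ae by (subst prod.atLeastLessThan_Suc) auto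
    finally show ?thesis .
  qed
  have Q2: "(\<Prod>i\<in>{a..<e}. x (Suc i) + y (Suc m)) = Q"
    unfolding Q_def by (rule prod.shift_bounds_Suc_ivl[symmetric])
  have Q3: "(\<Prod>i\<in>{a..<Suc e}. x i + y (Suc m)) = (x a + y (Suc m)) * Q"
    unfolding Q_def using ae by (subst prod.atLeast_Suc_lessThan) auto
  have s1: "box_sum x y a (Suc e) b (Suc m)
      = Q * (x (Suc e) + y (Suc m)) * box_sum x y a (Suc e) b m
        + ?P a * box_sum x y (Suc a) (Suc e) b (Suc m)"
    using box_sum_split[of a "Suc e" b m x y] ae bm unfolding Q1 by simp
  have s2: "box_sum x y a e b (Suc m)
      = Q * box_sum x y a e b m + ?P a * box_sum x y (Suc a) e b (Suc m)"
    using box_sum_split[of a e b m x y] ae bm unfolding Q2 by simp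
  have s3: "box_sum x y (Suc a) (Suc e) b (Suc m)
      = Q * box_sum x y (Suc a) (Suc e) b m + ?P (Suc e) * box_sum x y (Suc a) e b (Suc m)"
    using step.IH unfolding Q_def .
  have s4: "(x a - x (Suc e)) * box_sum x y a (Suc e) b m
      = ?P a * box_sum x y (Suc a) (Suc e) b m - ?P (Suc e) * box_sum x y a e b m"
    using dd[of a e] ae by simp
  show ?case unfolding Q3 using s1 s2 s3 s4 by algebra
qed

text \<open>
  Multiply \<open>box_sum_split\<close> by \<open>x a + q\<close> and its reflected form by \<open>x (Suc e) + q\<close>, where \<open>q\<close> is
  the last column variable. The terms with fewer columns then coincide and drop out of the
  difference, and the factors \<open>x a + q\<close> and \<open>x (Suc e) + q\<close> complete the two row products.
\<close>

lemma box_sum_divided_difference: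
  assumes "b \<le> m" "a \<le> e"
  shows "(x a - x (Suc e)) * box_sum x y a (Suc e) b m =
           (\<Prod>j\<in>{b..<Suc m}. x a + y j) * box_sum x y (Suc a) (Suc e) b m
         - (\<Prod>j\<in>{b..<Suc m}. x (Suc e) + y j) * box_sum x y a e b m"
  using assms
proof (induction m arbitrary: a e rule: dec_induct)
  case base
  show ?case by simp
next
  case (step m)
  define q where "q = y (Suc m)"
  let ?P = "\<lambda>i. \<Prod>j\<in>{b..<Suc m}. x i + y j"
  have P: "(\<Prod>j\<in>{b..<Suc (Suc m)}. x i + y j) = ?P i * (x i + q)" for i
    unfolding q_def using step.hyps by (subst prod.atLeastLessThan_Suc) auto
  define A where "A = (\<Prod>i\<in>{a..<Suc e}. x i + q)"
  define A' where "A' = (\<Prod>i\<in>{a..<Suc e}. x (Suc i) + q)"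
  have AA': "(x a + q) * A' = A * (x (Suc e) + q)"
  proof -
    have "(\<Prod>i\<in>{a..<Suc (Suc e)}. x i + q) = (x a + q) * (\<Prod>i\<in>{Suc a..<Suc (Suc e)}. x i + q)"
      using step.prems by (subst prod.atLeast_Suc_lessThan) auto
    also have "(\<Prod>i\<in>{Suc a..<Suc (Suc e)}. x i + q) = A'"
      unfolding A'_def by (rule prod.shift_bounds_Suc_ivl)
    finally show ?thesis
      unfolding A_def using step.prems by (subst (asm) prod.atLeastLessThan_Suc) auto
  qed
  have s1: "box_sum x y a (Suc e) b (Suc m)
      = A' * box_sum x y a (Suc e) b m + ?P a * box_sum x y (Suc a) (Suc e) b (Suc m)"
    using box_sum_split[of a "Suc e" b m x y] step unfolding A'_def q_def by simp
  have s2: "box_sum x y a (Suc e) b (Suc m)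
      = A * box_sum x y a (Suc e) b m + ?P (Suc e) * box_sum x y a e b (Suc m)"
    using box_sum_split_reflected_if[OF step.IH, of a e] step unfolding A_def q_def by simp
  show ?case unfolding P using s1 s2 AA' by algebra
qed

lemma box_sum_split_reflected:
  assumes "a \<le> e" "b \<le> m"
  shows "box_sum x y a (Suc e) b (Suc m) =
           (\<Prod>i\<in>{a..<Suc e}. x i + y (Suc m)) * box_sum x y a (Suc e) b m
         + (\<Prod>j\<in>{b..<Suc m}. x (Suc e) + y j) * box_sum x y a e b (Suc m)"
  using assms by (intro box_sum_split_reflected_if box_sum_divided_difference)

lemma box_sum_slice:
  assumes "a \<le> a'" "b \<le> m"
    and pos: "\<And>i j. a \<le> i \<Longrightarrow> i \<le> a' \<Longrightarrow> b \<le> j \<Longrightarrow> j \<le> Suc m \<Longrightarrow> 0 \<le> x i + y j"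
  shows "(\<Prod>i\<in>{a..<a'}. x i + y (Suc m)) * box_sum x y a a' b m \<le> box_sum x y a a' b (Suc m)"
proof (cases "a = a'")
  case True
  then show ?thesis by simp
next
  case False
  then obtain e where e: "a' = Suc e" "a \<le> e" using assms(1) by (cases a') auto
  have "0 \<le> (\<Prod>j\<in>{b..<Suc m}. x (Suc e) + y j)"
    using pos e by (intro prod_nonneg) auto
  moreover have "0 \<le> box_sum x y a e b (Suc m)"
    unfolding box_sum_def by (rule lower_sum_nonneg) (use pos e in auto)
  ultimately show ?thesis
    using box_sum_split_reflected[OF e(2) assms(2), of x y] e(1) by simp
qed

section \<open>Slicing off the last column\<close>

text \<open>
  Split at any \<open>(p, s) \<in> B\<close>. The cells above \<open>(p, s)\<close> in the order all lie in \<open>B\<close>, and the cells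
  below it in the order consist of columns \<open>\<le> s < m\<close> of the rectangle and of cells of \<open>B\<close>.
  Hence the coefficients are the same with and without column \<open>m\<close>, and both remainders are
  a rectangle with a smaller set \<open>B\<close>. The rectangle may lose columns on the left, which is
  why the hypothesis on rectangles is needed for every first column \<open>l\<close>.
\<close>

lemma lower_sum_slice:
  fixes f g :: "cell \<Rightarrow> 'b::linordered_semidom"
  assumes "finite B"
    and "\<And>c. 0 \<le> f c" "\<And>c. 0 \<le> g c"
    and box: "\<And>l. l0 \<le> l \<Longrightarrow> l \<le> m \<Longrightarrow>
        q * lower_sum f g ({a..<a'} \<times> {l..<m}) \<le> lower_sum f g ({a..<a'} \<times> {l..<Suc m})"
    and "\<And>i j. (i, j) \<in> B \<Longrightarrow> a' \<le> i \<and> j < m"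
    and "l0 \<le> l" "l \<le> m"
  shows "q * lower_sum f g ({a..<a'} \<times> {l..<m} \<union> B) \<le> lower_sum f g ({a..<a'} \<times> {l..<Suc m} \<union> B)"
  using assms(1,5,6,7)
proof (induction B arbitrary: l rule: finite_psubset_induct)
  case (psubset B)
  show ?case
  proof (cases "B = {}")
    case True
    then show ?thesis using box psubset.prems by simp
  next
    case False
    then obtain p s where c: "(p, s) \<in> B" by auto
    then have ps: "a' \<le> p" "s < m" using psubset.prems by auto
    define l' where "l' = max l (Suc s)"
    define L where "L = {a..<a'} \<times> {l..<Suc s} \<union> {d\<in>B. d \<le> (p, s)}"
    define U where "U = {d\<in>B. (p, s) \<le> d}"
    define BL where "BL = B - {d\<in>B. d \<le> (p, s)}"
    define BU where "BU = B - U"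
    have split: "lower_sum f g ({a..<a'} \<times> {l..<n} \<union> B) =
          prod f L * lower_sum f g ({a..<a'} \<times> {l'..<n} \<union> BL)
        + prod g U * lower_sum f g ({a..<a'} \<times> {l..<n} \<union> BU)" if n: "m \<le> n" for n
    proof -
      let ?D = "{a..<a'} \<times> {l..<n} \<union> B"
      have "{d\<in>?D. d \<le> (p, s)} = L" "{d\<in>?D. (p, s) \<le> d} = U"
        using ps n by (auto simp: L_def U_def)
      moreover have "?D - L = {a..<a'} \<times> {l'..<n} \<union> BL"
        using ps n psubset.prems(1) by (fastforce simp: L_def BL_def l'_def)
      moreover have "?D - U = {a..<a'} \<times> {l..<n} \<union> BU"
        using ps psubset.prems(1) by (fastforce simp: U_def BU_def)
      ultimately show ?thesis
        using lower_sum_split[of ?D "(p, s)" f g] c psubset.hyps by simp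
    qed
    have sub: "BL \<subset> B" "BU \<subset> B" using c by (auto simp: BL_def BU_def U_def)
    have IH1: "q * lower_sum f g ({a..<a'} \<times> {l'..<m} \<union> BL)
        \<le> lower_sum f g ({a..<a'} \<times> {l'..<Suc m} \<union> BL)"
      by (rule psubset.IH[OF sub(1)]) (use psubset.prems sub ps in \<open>auto simp: l'_def\<close>)
    have IH2: "q * lower_sum f g ({a..<a'} \<times> {l..<m} \<union> BU)
        \<le> lower_sum f g ({a..<a'} \<times> {l..<Suc m} \<union> BU)"
      by (rule psubset.IH[OF sub(2)]) (use psubset.prems sub in auto)
    have "0 \<le> prod f L" "0 \<le> prod g U" using assms(2,3) by (auto intro: prod_nonneg)
    then have "prod f L * (q * lower_sum f g ({a..<a'} \<times> {l'..<m} \<union> BL))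
         + prod g U * (q * lower_sum f g ({a..<a'} \<times> {l..<m} \<union> BU))
       \<le> lower_sum f g ({a..<a'} \<times> {l..<Suc m} \<union> B)"
      unfolding split[of "Suc m", simplified] using IH1 IH2 by (intro add_mono mult_left_mono)
    then show ?thesis unfolding split[of m, simplified] by (simp add: algebra_simps)
  qed
qed

section \<open>Hook lengths\<close>

definition column_length :: "(nat \<Rightarrow> nat) \<Rightarrow> nat \<Rightarrow> nat" where
  "column_length lam j = card {i. (i, j) \<in> young_diagram lam}"

lemma partition_antimono:
  assumes "is_partition lam" "1 \<le> i" "i \<le> i'"
  shows "lam i' \<le> lam i"
  using assms(3) by (induction i' rule: dec_induct)
    (use assms(1,2) in \<open>auto simp: is_partition_def intro: order_trans\<close>)

lemma young_diagram_down:
  assumes "is_partition lam" "(i', j') \<in> young_diagram lam" "1 \<le> i" "i \<le> i'" "1 \<le> j" "j \<le> j'"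
  shows "(i, j) \<in> young_diagram lam"
  using assms partition_antimono[OF assms(1,3,4)] by (auto simp: young_diagram_def)

text \<open>
  The row part of a hook ends at column \<open>lam i\<close> and the column part at row
  \<open>column_length lam j\<close>. So the first end depends on the row only and the second on the
  column only, while the start \<open>(i, j)\<close> enters additively.
\<close>

lemma hook_length_additive:
  assumes lam: "is_partition lam" and c: "(i, j) \<in> young_diagram lam"
  shows "int (hook_length lam (i, j)) =
           (int (lam i) - int i + 1) + (int (column_length lam j) - int j)"
proof -
  have ij: "1 \<le> i" "1 \<le> j" "j \<le> lam i" using c by (auto simp: young_diagram_def)
  note fin = finite_young_diagram[OF lam]
  let ?leg = "{i'. i < i' \<and> (i', j) \<in> young_diagram lam}"
  let ?col = "{i'. (i', j) \<in> young_diagram lam}"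
  have fincol: "finite ?col"
    by (rule finite_subset[OF _ finite_imageI[OF fin, of fst]]) force
  then have finleg: "finite ?leg" by (rule rev_finite_subset) auto
  have "{d \<in> young_diagram lam.
             (fst d = fst (i, j) \<and> snd (i, j) \<le> snd d) \<or> (snd d = snd (i, j) \<and> fst (i, j) < fst d)}
      = Pair i ` {j..lam i} \<union> (\<lambda>i'. (i', j)) ` ?leg"
    using ij by (auto simp: young_diagram_def)
  then have "hook_length lam (i, j) = card (Pair i ` {j..lam i} \<union> (\<lambda>i'. (i', j)) ` ?leg)"
    unfolding hook_length_def by simp
  also have "\<dots> = card (Pair i ` {j..lam i}) + card ((\<lambda>i'. (i', j)) ` ?leg)"
    by (rule card_Un_disjoint) (use finleg in auto)
  also have "\<dots> = (Suc (lam i) - j) + card ?leg"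
    by (simp add: card_image inj_on_def)
  finally have h: "hook_length lam (i, j) = (Suc (lam i) - j) + card ?leg" .
  have "?col = {1..i} \<union> ?leg"
    using young_diagram_down[OF lam c, of _ j] ij by (auto simp: young_diagram_def)
  then have "column_length lam j = card ({1..i} \<union> ?leg)" by (simp add: column_length_def)
  also have "\<dots> = i + card ?leg" using finleg by (subst card_Un_disjoint) auto
  finally show ?thesis using h ij by simp
qed

section \<open>Circle-square weights as lower sums\<close>

definition slide :: "cell \<Rightarrow> cell" where
  "slide c = (fst c + 1, snd c + 1)"

lemma slide_pair [simp]: "slide (i, j) = (i + 1, j + 1)"
  by (simp add: slide_def)

lemma inj_slide: "inj slide"
  by (auto simp: inj_def slide_def prod_eq_iff)

text \<open>
  A straight shape whose top left corner is at \<open>(a, b)\<close>. The empty set qualifies, so that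
  the property survives the removal of columns.
\<close>

definition straight_shape_at :: "nat \<Rightarrow> nat \<Rightarrow> cell set \<Rightarrow> bool" where
  "straight_shape_at a b D \<longleftrightarrow>
     (\<forall>(i, j)\<in>D. a \<le> i \<and> b \<le> j) \<and>
     (\<forall>(i, j)\<in>D. \<forall>i' j'. a \<le> i' \<longrightarrow> i' \<le> i \<longrightarrow> b \<le> j' \<longrightarrow> j' \<le> j \<longrightarrow> (i', j') \<in> D)"

lemma straight_shape_atD:
  assumes "straight_shape_at a b D" "(i, j) \<in> D"
  shows "a \<le> i" "b \<le> j"
    and "\<And>i' j'. a \<le> i' \<Longrightarrow> i' \<le> i \<Longrightarrow> b \<le> j' \<Longrightarrow> j' \<le> j \<Longrightarrow> (i', j') \<in> D"
  using assms unfolding straight_shape_at_def by blast+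

text \<open>
  Comparisons are only required between neighbouring diagonals, but in a straight shape any
  two comparable cells are joined by unit steps inside the shape, and a unit step changes
  the diagonal by one.
\<close>

lemma admissible_move_moved_upward:
  assumes adm: "admissible_move lam D D' \<eta>" and str: "straight_shape_at a b D"
    and sub: "D \<subseteq> young_diagram lam"
    and cd: "c \<in> D" "d \<in> D" "c \<le> d" and moved: "\<eta> c \<noteq> c"
  shows "\<eta> d \<noteq> d"
proof -
  obtain i j i' j' where ij: "c = (i, j)" "d = (i', j')" "i \<le> i'" "j \<le> j'"
    using cd(3) by (cases c, cases d) auto
  have choice: "\<eta> (p, q) \<in> {(p, q), (p + 1, q + 1)}" if "(p, q) \<in> D" for p q
    using adm that unfolding admissible_move_def by blast
  have mono: "\<eta> (p, q) \<le> \<eta> (p', q')"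
    if "(p, q) \<in> D" "(p', q') \<in> D" "(p, q) \<le> (p', q')"
      "int q - int p \<in> {k, k + 1}" "int q' - int p' \<in> {k, k + 1}" for p q p' q' k
  proof -
    have "mono_on (D \<inter> (diagonal lam k \<union> diagonal lam (k + 1))) \<eta>"
      using adm by (simp add: admissible_move_def)
    moreover have "(p, q) \<in> D \<inter> (diagonal lam k \<union> diagonal lam (k + 1))"
        "(p', q') \<in> D \<inter> (diagonal lam k \<union> diagonal lam (k + 1))"
      using that sub by (auto simp: diagonal_def)
    ultimately show ?thesis using that(3) by (rule mono_onD)
  qed
  have row: "\<eta> (p, Suc q) \<noteq> (p, Suc q)"
    if "(p, q) \<in> D" "(p, Suc q) \<in> D" "\<eta> (p, q) \<noteq> (p, q)" for p q
    using choice[OF that(1)] mono[OF that(1,2), of "int q - int p"] that(3) by auto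
  have col: "\<eta> (Suc p, q) \<noteq> (Suc p, q)"
    if "(p, q) \<in> D" "(Suc p, q) \<in> D" "\<eta> (p, q) \<noteq> (p, q)" for p q
    using choice[OF that(1)] mono[OF that(1,2), of "int q - int p - 1"] that(3) by auto
  have ab: "a \<le> i" "b \<le> j" using straight_shape_atD(1,2)[OF str] cd ij by auto
  have inD: "(p, q) \<in> D" if "a \<le> p" "p \<le> i'" "b \<le> q" "q \<le> j'" for p q
    using straight_shape_atD(3)[OF str, of i' j' p q] cd ij that by auto
  have "q \<le> j' \<longrightarrow> \<eta> (i, q) \<noteq> (i, q)" if "j \<le> q" for q
    using that
  proof (induction q rule: dec_induct)
    case base
    then show ?case using moved ij by simp
  next
    case (step q)
    then show ?case using row[of i q] inD[of i q] inD[of i "Suc q"] ab ij by auto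
  qed
  then have r: "\<eta> (i, j') \<noteq> (i, j')" using ij by simp
  have "p \<le> i' \<longrightarrow> \<eta> (p, j') \<noteq> (p, j')" if "i \<le> p" for p
    using that
  proof (induction p rule: dec_induct)
    case base
    then show ?case using r by simp
  next
    case (step p)
    then show ?case using col[of p j'] inD[of p j'] inD[of "Suc p" j'] ab ij by auto
  qed
  then show ?thesis using ij by simp
qed

definition slide_outside :: "cell set \<Rightarrow> cell set \<Rightarrow> cell set" where
  "slide_outside D V = V \<union> slide ` (D - V)"

text \<open>
  By the previous lemma the cells that stay form a lower set. Conversely, keeping a lower
  set \<open>V\<close> and sliding the rest is monotone on all of \<open>D\<close>, hence on neighbouring diagonals.
  It is injective because a cell could only slide onto a larger cell that stays, which the
  lower set property excludes.
\<close>

lemma admissible_outcomes: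
  assumes fin: "finite D" and str: "straight_shape_at a b D"
    and sub: "D \<subseteq> young_diagram lam" "slide ` D \<subseteq> young_diagram lam"
  shows "{D'. subdiagram lam D' \<and> (\<exists>\<eta>. admissible_move lam D D' \<eta>)}
       = slide_outside D ` lower_sets D"
proof (intro equalityI subsetI)
  fix D' assume "D' \<in> {D'. subdiagram lam D' \<and> (\<exists>\<eta>. admissible_move lam D D' \<eta>)}"
  then obtain \<eta> where adm: "admissible_move lam D D' \<eta>" by blast
  define V where "V = {c\<in>D. \<eta> c = c}"
  have "V \<in> lower_sets D"
    using admissible_move_moved_upward[OF adm str sub(1)]
    unfolding lower_sets_def V_def by blast
  moreover have "D' = slide_outside D V"
  proof -
    have "\<eta> c = slide c" if "c \<in> D - V" for c
      using adm that unfolding admissible_move_def V_def by (cases c) auto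
    then have "\<eta> ` (D - V) = slide ` (D - V)" by (intro image_cong) auto
    moreover have "\<eta> ` V = V" unfolding V_def by force
    moreover have "D' = \<eta> ` (V \<union> (D - V))"
      using adm unfolding admissible_move_def bij_betw_def V_def by (auto intro: arg_cong)
    ultimately show ?thesis unfolding slide_outside_def by (simp only: image_Un)
  qed
  ultimately show "D' \<in> slide_outside D ` lower_sets D" by blast
next
  fix D' assume "D' \<in> slide_outside D ` lower_sets D"
  then obtain V where V: "V \<in> lower_sets D" and D': "D' = slide_outside D V" by blast
  have VD: "V \<subseteq> D" and low: "\<And>c d. c \<in> V \<Longrightarrow> d \<in> D \<Longrightarrow> d \<le> c \<Longrightarrow> d \<in> V"
    using V by (auto simp: lower_sets_def)
  define \<eta> where "\<eta> c = (if c \<in> V then c else slide c)" for c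
  have le_slide: "c \<le> slide c" for c by (cases c) auto
  have slide_mono: "c \<le> d \<Longrightarrow> slide c \<le> slide d" for c d by (cases c, cases d) auto
  have "\<eta> ` D = D'"
    unfolding D' slide_outside_def \<eta>_def using VD by auto
  moreover have "inj_on \<eta> D"
  proof (rule inj_onI)
    fix c d assume "c \<in> D" "d \<in> D" "\<eta> c = \<eta> d"
    then show "c = d"
      using low le_slide injD[OF inj_slide] unfolding \<eta>_def by (metis)
  qed
  moreover have "\<eta> c \<le> \<eta> d" if "c \<in> D" "d \<in> D" "c \<le> d" for c d
    using that low[of d c] le_slide[of d] slide_mono[of c d] unfolding \<eta>_def
    by (auto intro: order_trans)
  ultimately have "admissible_move lam D D' \<eta>"
    unfolding admissible_move_def bij_betw_def by (auto simp: \<eta>_def intro!: mono_onI)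
  moreover have "subdiagram lam D'"
    unfolding subdiagram_def D' slide_outside_def using fin sub VD
    by (auto intro: finite_subset)
  ultimately show "D' \<in> {D'. subdiagram lam D' \<and> (\<exists>\<eta>. admissible_move lam D D' \<eta>)}" by blast
qed

text \<open>
  The outcome determines the lower set: a cell of \<open>V\<close> outside \<open>W\<close> would have to be reached
  from its upper left neighbour, which then is also in \<open>V\<close> and outside \<open>W\<close>, and this descent
  cannot continue forever.
\<close>

lemma slide_outside_subset:
  assumes V: "V \<in> lower_sets D" and W: "W \<in> lower_sets D"
    and eq: "slide_outside D V = slide_outside D W"
  shows "V \<subseteq> W"
proof
  fix c assume "c \<in> V"
  then show "c \<in> W"
  proof (induction "fst c" arbitrary: c rule: less_induct)
    case less
    have "c \<in> slide_outside D V" using less.prems by (simp add: slide_outside_def)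
    then have "c \<in> slide_outside D W" using eq by simp
    moreover have False if "c \<in> slide ` (D - W)"
    proof -
      obtain d where d: "d \<in> D - W" "c = slide d" using \<open>c \<in> slide ` (D - W)\<close> by blast
      then have "d \<le> c" "fst d < fst c" by (cases d; simp)+
      then have "d \<in> V" using V less.prems d by (auto simp: lower_sets_def)
      then show False using less.hyps[OF \<open>fst d < fst c\<close>] d by blast
    qed
    ultimately show ?case unfolding slide_outside_def by blast
  qed
qed

lemma wt_union: "wt lam (A + B) = wt lam A * wt lam B"
  by (simp add: wt_def)

lemma wt_mset_set: "wt lam (mset_set A) = prod (hook_length lam) A"
  by (simp add: wt_def prod_unfold_prod_mset)

lemma wt_cs_eq_lower_sum:
  assumes fin: "finite D" and str: "straight_shape_at a b D"
    and sub: "D \<subseteq> young_diagram lam" "slide ` D \<subseteq> young_diagram lam"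
  shows "wt_cs lam D F =
           wt lam F * lower_sum (hook_length lam) (\<lambda>c. hook_length lam (slide c)) D"
proof -
  have inj: "inj_on (slide_outside D) (lower_sets D)"
    by (intro inj_onI equalityI) (metis slide_outside_subset)+
  have "wt_cs lam D F = (\<Sum>V\<in>lower_sets D. wt lam (mset_set (slide_outside D V) + F))"
    unfolding wt_cs_def admissible_outcomes[OF assms] by (simp add: sum.reindex[OF inj])
  also have "\<dots> = (\<Sum>V\<in>lower_sets D. wt lam F *
      (prod (hook_length lam) V * (\<Prod>c\<in>D - V. hook_length lam (slide c))))"
  proof (rule sum.cong[OF refl])
    fix V assume V: "V \<in> lower_sets D"
    have "V \<inter> slide ` (D - V) = {}"
    proof (rule ccontr)
      assume "V \<inter> slide ` (D - V) \<noteq> {}"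
      then obtain d where "d \<in> D - V" "slide d \<in> V" by blast
      moreover have "d \<le> slide d" by (cases d) simp
      ultimately show False using V by (auto simp: lower_sets_def)
    qed
    moreover have "finite V" using V fin by (auto simp: lower_sets_def intro: finite_subset)
    ultimately have "prod (hook_length lam) (slide_outside D V)
        = prod (hook_length lam) V * prod (hook_length lam) (slide ` (D - V))"
      unfolding slide_outside_def using fin by (intro prod.union_disjoint) auto
    also have "prod (hook_length lam) (slide ` (D - V)) = (\<Prod>c\<in>D - V. hook_length lam (slide c))"
      by (subst prod.reindex) (auto intro: inj_on_subset[OF inj_slide])
    finally show "wt lam (mset_set (slide_outside D V) + F) = wt lam F *
      (prod (hook_length lam) V * (\<Prod>c\<in>D - V. hook_length lam (slide c)))"
      by (simp add: wt_union wt_mset_set mult.commute)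
  qed
  finally show ?thesis by (simp add: lower_sum_def sum_distrib_left)
qed

section \<open>The inequality\<close>

lemma straight_shape_at_normalized:
  assumes D: "finite D" "D \<noteq> {}" and mu: "is_partition mu" "normalized D = young_diagram mu"
  shows "straight_shape_at (Min (fst ` D)) (Min (snd ` D)) D"
proof -
  define a where "a = Min (fst ` D)"
  define b where "b = Min (snd ` D)"
  have ge: "a \<le> i \<and> b \<le> j" if "(i, j) \<in> D" for i j
    using D that unfolding a_def b_def by (force intro!: Min_le)
  have norm: "(\<lambda>(i, j). (i - a + 1, j - b + 1)) ` D = young_diagram mu"
    using mu(2) unfolding normalized_def Let_def a_def b_def .
  have "(i', j') \<in> D" if ij: "(i, j) \<in> D" "a \<le> i'" "i' \<le> i" "b \<le> j'" "j' \<le> j" for i j i' j'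
  proof -
    have "(i - a + 1, j - b + 1) \<in> young_diagram mu" using norm ij(1) by force
    then have "(i' - a + 1, j' - b + 1) \<in> young_diagram mu"
      by (rule young_diagram_down[OF mu(1)]) (use ij in auto)
    then obtain p q where pq: "(p, q) \<in> D" "i' - a + 1 = p - a + 1" "j' - b + 1 = q - b + 1"
      unfolding norm[symmetric] by auto
    then have "p = i'" "q = j'" using ge[OF pq(1)] ij by auto
    then show ?thesis using pq by simp
  qed
  then show ?thesis
    using ge unfolding straight_shape_at_def a_def[symmetric] b_def[symmetric] by blast
qed

text \<open>
  The last column occupies rows \<open>a..e\<close>. Its lowest cell \<open>(e, m)\<close> slides to a cell of the Young
  diagram, so the whole rectangle from \<open>(a, b)\<close> to \<open>(Suc e, Suc m)\<close> lies in the diagram. There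
  the hook lengths are additive and nonnegative, as \<open>box_sum_slice\<close> requires. If column
  \<open>m\<close> is empty, nothing is cut off.
\<close>

lemma lower_sum_hooks_slice_column:
  assumes lam: "is_partition lam" and fin: "finite D" and str: "straight_shape_at a b D"
    and sub: "D \<subseteq> young_diagram lam" "slide ` D \<subseteq> young_diagram lam"
    and cols: "\<And>i j. (i, j) \<in> D \<Longrightarrow> j \<le> m" and ab: "1 \<le> a" "1 \<le> b"
  defines "f \<equiv> hook_length lam"
  defines "g \<equiv> \<lambda>c. hook_length lam (slide c)"
  shows "(\<Prod>i | (i, m) \<in> D. hook_length lam (i, Suc m)) * lower_sum f g {(i, j)\<in>D. j < m}
       \<le> lower_sum f g D"
proof (cases "\<exists>i. (i, m) \<in> D")
  case False
  then have "{(i, j)\<in>D. j < m} = D" using cols by (force simp: le_less)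
  then show ?thesis using False by simp
next
  case True
  define I where "I = {i. (i, m) \<in> D}"
  have finI: "finite I"
    unfolding I_def by (rule finite_subset[OF _ finite_imageI[OF fin, of fst]]) force
  define e where "e = Max I"
  have eD: "(e, m) \<in> D" using Max_in[OF finI] True unfolding e_def I_def by auto
  then have ae: "a \<le> e" "b \<le> m" using straight_shape_atD(1,2)[OF str] by auto
  have I: "I = {a..<Suc e}"
  proof (intro equalityI subsetI)
    fix i assume i: "i \<in> I"
    then have "i \<le> e" unfolding e_def by (rule Max_ge[OF finI])
    moreover have "a \<le> i" using straight_shape_atD(1)[OF str, of i m] i by (simp add: I_def)
    ultimately show "i \<in> {a..<Suc e}" by simp
  next
    fix i assume "i \<in> {a..<Suc e}"
    then show "i \<in> I" using straight_shape_atD(3)[OF str eD, of i m] ae unfolding I_def by auto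
  qed
  define B where "B = {(i, j)\<in>D. e < i}"
  have box: "(i, j) \<in> D" if "a \<le> i" "i \<le> e" "b \<le> j" "j \<le> m" for i j
    using straight_shape_atD(3)[OF str eD] that by blast
  have Bcol: "j < m" if "(i, j) \<in> B" for i j
  proof -
    have "i \<notin> I" and ij: "(i, j) \<in> D" using that I by (auto simp: B_def)
    then have "j \<noteq> m" by (auto simp: I_def)
    then show ?thesis using cols[OF ij] by simp
  qed
  have D1: "{a..<Suc e} \<times> {b..<Suc m} \<union> B = D"
  proof (intro equalityI subsetI)
    fix c assume "c \<in> {a..<Suc e} \<times> {b..<Suc m} \<union> B"
    then show "c \<in> D" using box by (cases c) (auto simp: B_def)
  next
    fix c assume "c \<in> D"
    moreover obtain i j where "c = (i, j)" by (cases c)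
    ultimately show "c \<in> {a..<Suc e} \<times> {b..<Suc m} \<union> B"
      using cols[of i j] straight_shape_atD(1,2)[OF str, of i j] by (auto simp: B_def)
  qed
  have D2: "{a..<Suc e} \<times> {b..<m} \<union> B = {(i, j)\<in>D. j < m}"
    using Bcol unfolding D1[symmetric] by auto
  have "(Suc e, Suc m) \<in> young_diagram lam" using sub(2) eD by force
  then have corner: "(i, j) \<in> young_diagram lam"
    if "a \<le> i" "i \<le> Suc e" "b \<le> j" "j \<le> Suc m" for i j
    using young_diagram_down[OF lam, of "Suc e" "Suc m" i j] that ab by simp
  define x where "x i = int (lam i) - int i + 1" for i
  define y where "y j = int (column_length lam j) - int j" for j
  have hook: "int (hook_length lam (i, j)) = x i + y j"
    if "a \<le> i" "i \<le> Suc e" "b \<le> j" "j \<le> Suc m" for i j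
    using hook_length_additive[OF lam corner[OF that]] by (simp add: x_def y_def)
  have boxes: "int (lower_sum f g ({a..<Suc e} \<times> {l..<n})) = box_sum x y a (Suc e) l n"
    if "b \<le> l" "n \<le> Suc m" for l n
    unfolding of_nat_lower_sum box_sum_def f_def g_def
    by (rule lower_sum_cong) (use that in \<open>auto simp: hook\<close>)
  define q where "q = (\<Prod>i\<in>{a..<Suc e}. hook_length lam (i, Suc m))"
  have q: "int q = (\<Prod>i\<in>{a..<Suc e}. x i + y (Suc m))"
    unfolding q_def of_nat_prod by (rule prod.cong) (use ae in \<open>auto simp: hook\<close>)
  have boxes_le: "q * lower_sum f g ({a..<Suc e} \<times> {l..<m})
      \<le> lower_sum f g ({a..<Suc e} \<times> {l..<Suc m})" if l: "b \<le> l" "l \<le> m" for l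
  proof -
    have "(\<Prod>i\<in>{a..<Suc e}. x i + y (Suc m)) * box_sum x y a (Suc e) l m
        \<le> box_sum x y a (Suc e) l (Suc m)"
    proof (rule box_sum_slice)
      fix i j assume "a \<le> i" "i \<le> Suc e" "l \<le> j" "j \<le> Suc m"
      then show "0 \<le> x i + y j" using l by (simp add: hook[symmetric])
    qed (use ae l in auto)
    then have "int (q * lower_sum f g ({a..<Suc e} \<times> {l..<m}))
        \<le> int (lower_sum f g ({a..<Suc e} \<times> {l..<Suc m}))"
      using l by (simp add: boxes q)
    then show "q * lower_sum f g ({a..<Suc e} \<times> {l..<m})
        \<le> lower_sum f g ({a..<Suc e} \<times> {l..<Suc m})"
      by (simp only: of_nat_le_iff)
  qed
  have finB: "finite B" unfolding B_def by (rule finite_subset[OF _ fin]) auto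
  have "q * lower_sum f g ({a..<Suc e} \<times> {b..<m} \<union> B)
      \<le> lower_sum f g ({a..<Suc e} \<times> {b..<Suc m} \<union> B)"
    by (rule lower_sum_slice[OF finB _ _ boxes_le])
      (use ae Bcol in \<open>auto simp: B_def\<close>)
  moreover have "(\<Prod>i | (i, m) \<in> D. hook_length lam (i, Suc m)) = q"
    unfolding q_def I[symmetric] I_def ..
  ultimately show ?thesis unfolding D1 D2 by simp
qed

lemma lower_sum_hooks_slice:
  assumes lam: "is_partition lam" and fin: "finite D" and str: "straight_shape_at a b D"
    and sub: "D \<subseteq> young_diagram lam" "slide ` D \<subseteq> young_diagram lam"
    and ab: "1 \<le> a" "1 \<le> b"
  defines "f \<equiv> hook_length lam"
  defines "g \<equiv> \<lambda>c. hook_length lam (slide c)"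
  shows "prod (hook_length lam) (push_right (later_columns k D)) * lower_sum f g (first_columns k D)
       \<le> lower_sum f g D"
proof -
  obtain N where N: "\<And>i j. (i, j) \<in> D \<Longrightarrow> j \<le> N" "k \<le> N"
  proof
    fix i j assume "(i, j) \<in> D"
    then have "j \<le> Max (snd ` D)" using fin by (force intro: Max_ge)
    then show "j \<le> max k (Max (snd ` D))" by simp
  qed simp
  let ?P = "\<lambda>n. prod (hook_length lam) (push_right (later_columns k (first_columns n D)))"
  have "?P n * lower_sum f g (first_columns k D) \<le> lower_sum f g (first_columns n D)"
    if "k \<le> n" for n
    using that
  proof (induction n rule: dec_induct)
    case base
    have "later_columns k (first_columns k D) = {}"
      by (auto simp: later_columns_def first_columns_def)
    then show ?case by (simp add: push_right_def)
  next
    case (step n)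
    let ?E = "first_columns (Suc n) D"
    let ?new = "\<Prod>i | (i, Suc n) \<in> ?E. hook_length lam (i, Suc (Suc n))"
    have E: "?E \<subseteq> D" by (auto simp: first_columns_def)
    have finE: "finite ?E" by (rule finite_subset[OF E fin])
    have strE: "straight_shape_at a b ?E"
      using str unfolding straight_shape_at_def first_columns_def by fastforce
    have En: "{(i, j)\<in>?E. j < Suc n} = first_columns n D"
      by (auto simp: first_columns_def)
    have "?new * lower_sum f g {(i, j)\<in>?E. j < Suc n} \<le> lower_sum f g ?E"
      unfolding f_def g_def
      by (rule lower_sum_hooks_slice_column[OF lam finE strE])
        (use E sub ab in \<open>auto simp: first_columns_def\<close>)
    then have new: "?new * lower_sum f g (first_columns n D) \<le> lower_sum f g ?E"
      unfolding En .
    have "?P (Suc n) = ?P n * ?new"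
    proof -
      let ?I = "{i. (i, Suc n) \<in> ?E}"
      let ?A = "push_right (later_columns k (first_columns n D))"
      let ?C = "(\<lambda>i. (i, Suc (Suc n))) ` ?I"
      have "push_right (later_columns k ?E) = ?A \<union> ?C"
        using step.hyps
        by (auto simp: push_right_def later_columns_def first_columns_def image_iff le_Suc_eq)
      moreover have "finite ?A"
        unfolding push_right_def later_columns_def first_columns_def
        by (rule finite_imageI, rule finite_subset[OF _ fin]) auto
      moreover have "finite ?I"
        by (rule finite_subset[OF _ finite_imageI[OF finE, of fst]]) force
      moreover have "?A \<inter> ?C = {}"
        by (auto simp: push_right_def later_columns_def first_columns_def)
      ultimately have "?P (Suc n) = ?P n * prod (hook_length lam) ?C"
        by (simp add: prod.union_disjoint)
      also have "prod (hook_length lam) ?C = ?new"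
        by (subst prod.reindex) (auto simp: inj_on_def)
      finally show ?thesis .
    qed
    then have "?P (Suc n) * lower_sum f g (first_columns k D)
        = ?new * (?P n * lower_sum f g (first_columns k D))" by simp
    also have "\<dots> \<le> ?new * lower_sum f g (first_columns n D)"
      using step.IH by (rule mult_left_mono) simp
    finally show ?case using new by simp
  qed
  moreover have "first_columns N D = D" using N by (auto simp: first_columns_def)
  ultimately show ?thesis using N(2) by metis
qed

theorem lemma3p2:
  fixes lam mu :: "nat \<Rightarrow> nat" and D :: "cell set" and F :: "cell multiset" and k :: nat
  assumes "is_partition lam"
    and "circle_square lam D F"
    and "is_partition mu"
    and "young_diagram mu \<noteq> {}"
    and "young_diagram mu \<subseteq> young_diagram lam"
    and "normalized D = young_diagram mu"
  shows "wt_cs lam D F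
           \<ge> wt_cs lam (first_columns k D) (F + mset_set (push_right (later_columns k D)))"
proof -
  have fin: "finite D" and sub: "D \<subseteq> young_diagram lam"
    and slide: "slide ` D \<subseteq> young_diagram lam"
    using assms(2) by (auto simp: circle_square_def subdiagram_def)
  have ne: "D \<noteq> {}" using assms(4,6) by (auto simp: normalized_def Let_def)
  define a where "a = Min (fst ` D)"
  define b where "b = Min (snd ` D)"
  have str: "straight_shape_at a b D"
    unfolding a_def b_def by (rule straight_shape_at_normalized[OF fin ne assms(3,6)])
  have "a \<in> fst ` D" "b \<in> snd ` D" unfolding a_def b_def using fin ne by (auto intro: Min_in)
  then have ab: "1 \<le> a" "1 \<le> b" using sub by (auto simp: young_diagram_def)
  let ?E = "first_columns k D"
  let ?W = "lower_sum (hook_length lam) (\<lambda>c. hook_length lam (slide c))"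
  let ?push = "prod (hook_length lam) (push_right (later_columns k D))"
  have E: "?E \<subseteq> D" by (auto simp: first_columns_def)
  have strE: "straight_shape_at a b ?E"
    using str unfolding straight_shape_at_def first_columns_def by fastforce
  have "wt_cs lam ?E (F + mset_set (push_right (later_columns k D))) = wt lam F * (?push * ?W ?E)"
    using wt_cs_eq_lower_sum[OF finite_subset[OF E fin] strE order_trans[OF E sub]
        order_trans[OF image_mono[OF E] slide]]
    by (simp add: wt_union wt_mset_set mult.assoc)
  also have "\<dots> \<le> wt lam F * ?W D"
    by (intro mult_left_mono lower_sum_hooks_slice[OF assms(1) fin str sub slide ab]) simp
  also have "\<dots> = wt_cs lam D F"
    by (rule wt_cs_eq_lower_sum[OF fin str sub slide, symmetric])
  finally show ?thesis .
qed

end
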